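(* Let $m,n$ be positive integers. (a) If both $m$ and $n$ are odd, then $D(K_m\,\Box\,K_n,2)\ge \frac{m+n}{2}-2+\frac{1}{2m}+\frac{1}{2n}$. (b) If $m$ is even and $n$ is odd, then $D(K_m\,\Box\,K_n,2)\ge \frac{m+n}{2}-2+\frac{1}{2n}$.
   Context: Graphs are finite and simple. For a graph $G$ and a positive integer $k$, a (fractional) $k$-coloring of $G$ is an assignment to every vertex $v$ of real numbers $f_1(v),\dots,f_k(v)\ge 0$ with $\sum_{j=1}^k f_j(v)=1$ ($f_j(v)$ is the usage of color $j$ at $v$). The defect of $v$ is $\mathrm{df}(v)=\sum_{w\in N(v)}\sum_{j=1}^k\min(f_j(v),f_j(w))$, where $N(v)$ is the set of neighbors of $v$. The defect of the coloring is $\max_v \mathrm{df}(v)$, and the minimum defect $D(G,k)$ is the minimum of this quantity over all $k$-colorings of $G$. $G\,\Box\,H$ denotes the Cartesian product: its vertex set is $V(G)\times V(H)$, and $(u_1,u_2)$, $(v_1,v_2)$ are adjacent if $u_1v_1\in E(G)$ and $u_2=v_2$, or $u_1=v_1$ and $u_2v_2\in E(H)$. $K_s$ is the complete graph on $s$ vertices. *)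

theory Defs
  imports "HOL-Analysis.Analysis"
begin

record 'a sgraph =
  verts :: "'a set"
  edges :: "'a set set"

definition simple_graph :: "'a sgraph \<Rightarrow> bool" where
  "simple_graph G \<longleftrightarrow> finite (verts G) \<and> edges G \<subseteq> {e. e \<subseteq> verts G \<and> card e = 2}"

definition neighbors :: "'a sgraph \<Rightarrow> 'a \<Rightarrow> 'a set" where
  "neighbors G v = {w. {v, w} \<in> edges G}"

definition complete_graph :: "nat \<Rightarrow> nat sgraph" where
  "complete_graph s = \<lparr> verts = {1..s}, edges = {e. e \<subseteq> {1..s} \<and> card e = 2} \<rparr>"

definition cart_prod :: "'a sgraph \<Rightarrow> 'b sgraph \<Rightarrow> ('a \<times> 'b) sgraph" (infixl "\<box>" 70) where
  "G \<box> H = \<lparr> verts = verts G \<times> verts H,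
     edges = {{(u1, u2), (v1, v2)} | u1 u2 v1 v2.
        {(u1, u2), (v1, v2)} \<subseteq> verts G \<times> verts H \<and>
        ({u1, v1} \<in> edges G \<and> u2 = v2 \<or> u1 = v1 \<and> {u2, v2} \<in> edges H)} \<rparr>"

text \<open>The value \<open>f v j\<close> is the usage of colour \<open>j\<close> at the vertex \<open>v\<close>. Nothing is
  required of \<open>f\<close> outside \<open>verts G \<times> {1..k}\<close>, where no other definition looks at it.\<close>

definition frac_coloring :: "'a sgraph \<Rightarrow> nat \<Rightarrow> ('a \<Rightarrow> nat \<Rightarrow> real) \<Rightarrow> bool" where
  "frac_coloring G k f \<longleftrightarrow>
     (\<forall>v\<in>verts G. (\<forall>j\<in>{1..k}. f v j \<ge> 0) \<and> (\<Sum>j=1..k. f v j) = 1)"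

definition vertex_defect :: "'a sgraph \<Rightarrow> nat \<Rightarrow> ('a \<Rightarrow> nat \<Rightarrow> real) \<Rightarrow> 'a \<Rightarrow> real" where
  "vertex_defect G k f v = (\<Sum>w\<in>neighbors G v. \<Sum>j=1..k. min (f v j) (f w j))"

definition coloring_defect :: "'a sgraph \<Rightarrow> nat \<Rightarrow> ('a \<Rightarrow> nat \<Rightarrow> real) \<Rightarrow> real" where
  "coloring_defect G k f = Max (vertex_defect G k f ` verts G)"

text \<open>For a nonempty simple graph and \<open>k > 0\<close> the least value below exists; this is lemma
  \<open>min_defect_attained\<close>.\<close>

definition min_defect :: "'a sgraph \<Rightarrow> nat \<Rightarrow> real" where
  "min_defect G k = (LEAST d. \<exists>f. frac_coloring G k f \<and> d = coloring_defect G k f)"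

lemma simple_complete_graph: "simple_graph (complete_graph s)"
  by (simp add: simple_graph_def complete_graph_def)

lemma simple_cart_prod:
  assumes "simple_graph G" "simple_graph H"
  shows "simple_graph (G \<box> H)"
proof -
  have "card {(u1, u2), (v1, v2)} = 2"
    if "{u1, v1} \<in> edges G \<and> u2 = v2 \<or> u1 = v1 \<and> {u2, v2} \<in> edges H" for u1 v1 u2 v2
  proof -
    have "card {u1, v1} = 2 \<or> card {u2, v2} = 2"
      using that assms by (auto simp: simple_graph_def)
    then have "(u1, u2) \<noteq> (v1, v2)" by auto
    then show ?thesis by simp
  qed
  then show ?thesis
    using assms unfolding simple_graph_def cart_prod_def by auto
qed

lemma neighbors_complete_graph:
  assumes "v \<in> verts (complete_graph s)"
  shows "neighbors (complete_graph s) v = {1..s} - {v}"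
  using assms by (auto simp: neighbors_def complete_graph_def card_2_iff doubleton_eq_iff)

lemma adjacent_cart_prod:
  assumes "(u1, u2) \<in> verts G \<times> verts H" "(v1, v2) \<in> verts G \<times> verts H"
  shows "{(u1, u2), (v1, v2)} \<in> edges (G \<box> H) \<longleftrightarrow>
    {u1, v1} \<in> edges G \<and> u2 = v2 \<or> u1 = v1 \<and> {u2, v2} \<in> edges H"
proof
  assume "{(u1, u2), (v1, v2)} \<in> edges (G \<box> H)"
  then show "{u1, v1} \<in> edges G \<and> u2 = v2 \<or> u1 = v1 \<and> {u2, v2} \<in> edges H"
    unfolding cart_prod_def by (auto simp: doubleton_eq_iff insert_commute)
next
  assume "{u1, v1} \<in> edges G \<and> u2 = v2 \<or> u1 = v1 \<and> {u2, v2} \<in> edges H"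
  then show "{(u1, u2), (v1, v2)} \<in> edges (G \<box> H)"
    unfolding cart_prod_def using assms by simp blast
qed

lemma neighbors_in_verts:
  assumes "simple_graph G"
  shows "neighbors G v \<subseteq> verts G"
  using assms by (auto simp: simple_graph_def neighbors_def)

lemma compact_funs:
  fixes T :: "'b::topological_space set"
  assumes "compact T"
  shows "compact {f :: 'a \<Rightarrow> 'b. \<forall>x. f x \<in> T}"
proof -
  have "compactin (product_topology (\<lambda>_. euclidean) UNIV) (PiE (UNIV :: 'a set) (\<lambda>_. T))"
    using assms by (simp add: compactin_PiE)
  moreover have "PiE (UNIV :: 'a set) (\<lambda>_. T) = {f. \<forall>x. f x \<in> T}"
    by (auto simp: PiE_def)
  ultimately show ?thesis
    by (simp add: euclidean_product_topology)
qed

lemma continuous_Max: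
  fixes g :: "'a \<Rightarrow> 'b::topological_space \<Rightarrow> real"
  assumes "finite V" "V \<noteq> {}" "\<And>v. v \<in> V \<Longrightarrow> continuous_on S (g v)"
  shows "continuous_on S (\<lambda>x. Max ((\<lambda>v. g v x) ` V))"
  using assms
proof (induction V rule: finite_ne_induct)
  case (singleton v)
  then show ?case by simp
next
  case (insert v V)
  then have "continuous_on S (\<lambda>x. max (g v x) (Max ((\<lambda>v. g v x) ` V)))"
    by (intro continuous_on_max) auto
  then show ?case using insert by simp
qed

lemma continuous_usage:
  "continuous_on S (\<lambda>f :: 'a \<Rightarrow> nat \<Rightarrow> real. f v j)"
proof -
  have "continuous_on S (\<lambda>f :: 'a \<Rightarrow> nat \<Rightarrow> real. f v)"
    by (rule continuous_on_product_then_coordinatewise) (rule continuous_on_id)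
  then show ?thesis by (rule continuous_on_product_then_coordinatewise)
qed

lemma min_defect_attained:
  assumes G: "simple_graph G" "verts G \<noteq> {}" and k: "k > 0"
  shows "\<exists>f. frac_coloring G k f \<and> coloring_defect G k f = min_defect G k"
    and "\<And>f. frac_coloring G k f \<Longrightarrow> min_defect G k \<le> coloring_defect G k f"
proof -
  define B where "B = {f :: 'a \<Rightarrow> nat \<Rightarrow> real. \<forall>v. f v \<in> {g. \<forall>j. g j \<in> {0..1}}}"
  define C where "C = {f :: 'a \<Rightarrow> nat \<Rightarrow> real. \<forall>v\<in>verts G. (\<Sum>j=1..k. f v j) = 1}"
  have B: "compact B"
    unfolding B_def by (intro compact_funs) simp
  have C: "closed C"
  proof -
    have "closed (\<Inter>v\<in>verts G. {f :: 'a \<Rightarrow> nat \<Rightarrow> real. (\<Sum>j=1..k. f v j) = 1})"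
      by (intro closed_INT ballI closed_Collect_eq continuous_on_sum continuous_usage
          continuous_on_const)
    moreover have "(\<Inter>v\<in>verts G. {f :: 'a \<Rightarrow> nat \<Rightarrow> real. (\<Sum>j=1..k. f v j) = 1}) = C"
      by (auto simp: C_def)
    ultimately show ?thesis by simp
  qed
  have BC: "compact (B \<inter> C)"
    using B C by (rule compact_Int_closed)
  have "(\<lambda>v j. if j = 1 then 1 else 0) \<in> B \<inter> C"
    using k by (auto simp: B_def C_def)
  then have ne: "B \<inter> C \<noteq> {}" by blast
  have cont: "continuous_on (B \<inter> C) (coloring_defect G k)"
    unfolding coloring_defect_def vertex_defect_def
    using G by (intro continuous_Max continuous_on_sum continuous_on_min continuous_usage)
      (auto simp: simple_graph_def)
  obtain f where f: "f \<in> B \<inter> C"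
    and f_min: "\<And>g. g \<in> B \<inter> C \<Longrightarrow> coloring_defect G k f \<le> coloring_defect G k g"
    using continuous_attains_inf[OF BC ne cont] by blast
  have f_col: "frac_coloring G k f"
    using f by (auto simp: B_def C_def frac_coloring_def)
  have le: "coloring_defect G k f \<le> coloring_defect G k g" if g: "frac_coloring G k g" for g
  proof -
    define h where "h = (\<lambda>v j. if v \<in> verts G \<and> j \<in> {1..k} then g v j else 0)"
    have h_eq: "h v j = g v j" if "v \<in> verts G" "j \<in> {1..k}" for v j
      using that by (simp add: h_def)
    have "g v j \<le> 1" if "v \<in> verts G" "j \<in> {1..k}" for v j
    proof -
      have "g v j \<le> (\<Sum>j=1..k. g v j)"
        using that g by (intro member_le_sum) (auto simp: frac_coloring_def)
      then show ?thesis using that g by (simp add: frac_coloring_def)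
    qed
    then have "h \<in> B"
      using g by (auto simp: B_def h_def frac_coloring_def)
    moreover have "h \<in> C"
      using g by (simp add: C_def h_eq frac_coloring_def)
    moreover have "vertex_defect G k h v = vertex_defect G k g v" if "v \<in> verts G" for v
      unfolding vertex_defect_def using that neighbors_in_verts[OF G(1)]
      by (intro sum.cong refl) (auto simp: h_eq subset_iff)
    then have "coloring_defect G k h = coloring_defect G k g"
      by (simp add: coloring_defect_def)
    ultimately show ?thesis using f_min[of h] by simp
  qed
  have eq: "min_defect G k = coloring_defect G k f"
    unfolding min_defect_def by (rule Least_equality) (use f_col le in auto)
  show "\<exists>f. frac_coloring G k f \<and> coloring_defect G k f = min_defect G k"
    using f_col eq by auto
  show "min_defect G k \<le> coloring_defect G k g" if "frac_coloring G k g" for g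
    using le[OF that] eq by simp
qed

end

theory Submission
  imports Defs
begin

text \<open>
  With two colours a colouring is a single function \<open>x\<close> with values in \<open>[0, 1]\<close> (the usage of
  colour 1), and the overlap of two vertices is \<open>1 - \<bar>x v - x w\<bar>\<close>. The defect of a vertex of the
  product is therefore its degree \<open>m + n - 2\<close> minus the spread \<open>\<Sum>\<bar>x v - x w\<bar>\<close> over its
  neighbours. The largest defect is at least the average one, and the average is controlled by
  summing the spread separately over the \<open>n\<close> copies of \<open>K\<^sub>m\<close> and the \<open>m\<close> copies of \<open>K\<^sub>n\<close>.

  Within one copy of \<open>K\<^sub>s\<close> the spread is a fractional cut, so summed over the edges it is at most the
  maximum cut \<open>\<lfloor>s\<^sup>2/4\<rfloor>\<close> (\<open>sum_abs_diff_le\<close>). This gives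
  \<open>D(K\<^sub>m \<box> K\<^sub>n, 2) \<ge> (m - 1 - 2\<lfloor>m\<^sup>2/4\<rfloor>/m) + (n - 1 - 2\<lfloor>n\<^sup>2/4\<rfloor>/n)\<close> for all \<open>m\<close> and \<open>n\<close>
  (\<open>min_defect_complete_prod_ge\<close>). A factor \<open>K\<^sub>s\<close> contributes \<open>s/2 - 1\<close> to this bound if \<open>s\<close> is
  even and \<open>s/2 - 1 + 1/(2s)\<close> if \<open>s\<close> is odd.
\<close>

text \<open>Remove a point \<open>i\<close> with the least value and another point \<open>j\<close> with the greatest value. Every
  other point lies between them, so its distances to \<open>i\<close> and \<open>j\<close> add up to \<open>x j - x i \<le> 1\<close>;
  hence the \<open>s + 2\<close> points have at most \<open>s + 1\<close> more total distance than the remaining \<open>s\<close>, which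
  is exactly the growth of \<open>\<lfloor>s\<^sup>2/4\<rfloor>\<close>. The sum runs over ordered pairs, whence the factor 2.\<close>

lemma sum_abs_diff_le:
  fixes x :: "'a \<Rightarrow> real"
  assumes "finite S" and "x ` S \<subseteq> {0..1}"
  shows "(\<Sum>u\<in>S. \<Sum>v\<in>S. \<bar>x u - x v\<bar>) \<le> 2 * real ((card S)\<^sup>2 div 4)"
  using assms
proof (induction "card S" arbitrary: S rule: less_induct)
  case less
  show ?case
  proof (cases "card S \<le> 1")
    case True
    then have "S = {} \<or> (\<exists>a. S = {a})"
      using less.prems(1) by (cases "card S") (auto simp: card_1_singleton_iff)
    then show ?thesis by auto
  next
    case False
    then have "S \<noteq> {}" by auto
    then obtain i where i: "i \<in> S" "\<And>w. w \<in> S \<Longrightarrow> x i \<le> x w"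
      using less.prems(1) arg_min_if_finite[of S x] by (metis not_less)
    have "S - {i} \<noteq> {}"
      using False subset_singletonD[of S i] by fastforce
    then obtain j where j: "j \<in> S - {i}" "\<And>w. w \<in> S - {i} \<Longrightarrow> x w \<le> x j"
      using less.prems(1) arg_min_if_finite[of "S - {i}" "\<lambda>w. - x w"]
      by (metis finite_Diff neg_less_iff_less not_less)
    define T where "T = S - {i} - {j}"
    have T: "finite T" "i \<notin> T" "j \<notin> T" "i \<noteq> j" "S = insert i (insert j T)"
      using i j less.prems(1) by (auto simp: T_def)
    then have card_S: "card S = card T + 2" by simp
    have "x i \<in> {0..1}" "x j \<in> {0..1}"
      using less.prems(2) T by auto
    then have ij: "x j - x i \<le> 1" "x i \<le> x j"
      using i(2)[of j] j(1) by auto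
    have between: "\<bar>x i - x w\<bar> + \<bar>x j - x w\<bar> = x j - x i" if "w \<in> T" for w
      using i(2)[of w] j(2)[of w] that unfolding T_def by auto
    have split: "(\<Sum>v\<in>S. g v) = g i + g j + (\<Sum>v\<in>T. g v)" for g :: "'a \<Rightarrow> real"
      using T(1-4) by (simp add: T(5))
    have swap: "(\<Sum>u\<in>T. \<bar>x u - c\<bar>) = (\<Sum>u\<in>T. \<bar>c - x u\<bar>)" for c
      by (intro sum.cong refl abs_minus_commute)
    have "(\<Sum>u\<in>S. \<Sum>v\<in>S. \<bar>x u - x v\<bar>)
        = 2 * (x j - x i) + 2 * (\<Sum>w\<in>T. \<bar>x i - x w\<bar> + \<bar>x j - x w\<bar>)
          + (\<Sum>u\<in>T. \<Sum>v\<in>T. \<bar>x u - x v\<bar>)"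
      using ij(2) by (simp add: split sum.distrib swap)
    also have "(\<Sum>w\<in>T. \<bar>x i - x w\<bar> + \<bar>x j - x w\<bar>) = real (card T) * (x j - x i)"
      using between by simp
    also have "\<dots> \<le> real (card T)"
      using ij by (simp add: mult_left_le)
    also have "(\<Sum>u\<in>T. \<Sum>v\<in>T. \<bar>x u - x v\<bar>) \<le> 2 * real ((card T)\<^sup>2 div 4)"
    proof (rule less.hyps)
      show "x ` T \<subseteq> {0..1}" using less.prems(2) by (auto simp: T_def)
    qed (simp_all add: card_S T(1))
    finally have "(\<Sum>u\<in>S. \<Sum>v\<in>S. \<bar>x u - x v\<bar>)
        \<le> 2 * (real ((card T)\<^sup>2 div 4) + real (card T) + 1)"
      using ij by simp
    moreover have "(card S)\<^sup>2 div 4 = (card T)\<^sup>2 div 4 + card T + 1"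
    proof -
      have "(card S)\<^sup>2 = (card T)\<^sup>2 + 4 * (card T + 1)"
        by (simp add: card_S power2_eq_square)
      then show ?thesis by simp
    qed
    ultimately show ?thesis by simp
  qed
qed

lemma neighbors_complete_prod:
  assumes "u \<in> {1..m}" and "v \<in> {1..n}"
  shows "neighbors (complete_graph m \<box> complete_graph n) (u, v)
    = ({1..m} - {u}) \<times> {v} \<union> {u} \<times> ({1..n} - {v})"
proof -
  let ?G = "complete_graph m \<box> complete_graph n"
  have verts_K: "verts (complete_graph s) = {1..s}" for s
    by (simp add: complete_graph_def)
  have verts_G: "verts ?G = {1..m} \<times> {1..n}"
    by (simp add: cart_prod_def verts_K)
  have K: "{a, b} \<in> edges (complete_graph s) \<longleftrightarrow> b \<in> {1..s} - {a}" if "a \<in> {1..s}" for a b s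
  proof -
    have "b \<in> neighbors (complete_graph s) a \<longleftrightarrow> b \<in> {1..s} - {a}"
      using neighbors_complete_graph[of a s] that by (simp only: verts_K)
    then show ?thesis by (simp add: neighbors_def)
  qed
  have verts: "neighbors ?G (u, v) \<subseteq> {1..m} \<times> {1..n}"
    using neighbors_in_verts[of ?G] unfolding verts_G
    by (simp add: simple_cart_prod simple_complete_graph)
  have adj: "(a, b) \<in> neighbors ?G (u, v) \<longleftrightarrow>
      a \<in> {1..m} - {u} \<and> v = b \<or> u = a \<and> b \<in> {1..n} - {v}"
    if "a \<in> {1..m}" "b \<in> {1..n}" for a b
    using adjacent_cart_prod[of u v "complete_graph m" "complete_graph n" a b] that assms
    unfolding verts_K by (simp add: neighbors_def K)
  have rhs: "({1..m} - {u}) \<times> {v} \<union> {u} \<times> ({1..n} - {v}) \<subseteq> {1..m} \<times> {1..n}"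
    using assms by auto
  show ?thesis
  proof (rule set_eqI)
    fix w
    show "w \<in> neighbors ?G (u, v) \<longleftrightarrow>
        w \<in> ({1..m} - {u}) \<times> {v} \<union> {u} \<times> ({1..n} - {v})"
    proof (cases "w \<in> {1..m} \<times> {1..n}")
      case True
      then obtain a b where w: "w = (a, b)" "a \<in> {1..m}" "b \<in> {1..n}" by blast
      show ?thesis unfolding w(1) adj[OF w(2,3)] by auto
    next
      case False
      then show ?thesis using verts rhs by blast
    qed
  qed
qed

text \<open>The sums may include the vertex itself, whose distance to itself is 0; this makes them full
  row and column sums, ready for the bound on one copy.\<close>

lemma vertex_defect_complete_prod:
  fixes f :: "nat \<times> nat \<Rightarrow> nat \<Rightarrow> real"
  assumes f: "frac_coloring (complete_graph m \<box> complete_graph n) 2 f"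
    and u: "u \<in> {1..m}" and v: "v \<in> {1..n}"
  shows "vertex_defect (complete_graph m \<box> complete_graph n) 2 f (u, v)
    = real m + real n - 2 - (\<Sum>a=1..m. \<bar>f (u, v) 1 - f (a, v) 1\<bar>)
        - (\<Sum>b=1..n. \<bar>f (u, v) 1 - f (u, b) 1\<bar>)"
proof -
  have overlap: "(\<Sum>j=1..2. min (f (u, v) j) (f (a, b) j)) = 1 - \<bar>f (u, v) 1 - f (a, b) 1\<bar>"
    if "a \<in> {1..m}" "b \<in> {1..n}" for a b
  proof -
    have "f (c, d) 2 = 1 - f (c, d) 1" if "c \<in> {1..m}" "d \<in> {1..n}" for c d
    proof -
      have "(c, d) \<in> verts (complete_graph m \<box> complete_graph n)"
        using that by (simp add: cart_prod_def complete_graph_def)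
      then have "(\<Sum>j=1..2. f (c, d) j) = 1"
        using f unfolding frac_coloring_def by blast
      then show ?thesis by (simp add: numeral_2_eq_2)
    qed
    from this[OF u v] this[OF that] show ?thesis
      by (simp add: numeral_2_eq_2 min_def)
  qed
  have "vertex_defect (complete_graph m \<box> complete_graph n) 2 f (u, v)
      = (\<Sum>w\<in>({1..m} - {u}) \<times> {v} \<union> {u} \<times> ({1..n} - {v}). 1 - \<bar>f (u, v) 1 - f w 1\<bar>)"
    unfolding vertex_defect_def neighbors_complete_prod[OF u v]
    by (rule sum.cong[OF refl]) (use u v overlap in auto)
  also have "\<dots> = (\<Sum>w\<in>({1..m} - {u}) \<times> {v}. 1 - \<bar>f (u, v) 1 - f w 1\<bar>)
      + (\<Sum>w\<in>{u} \<times> ({1..n} - {v}). 1 - \<bar>f (u, v) 1 - f w 1\<bar>)"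
    by (rule sum.union_disjoint) auto
  also have "\<dots> = (\<Sum>a\<in>{1..m} - {u}. 1 - \<bar>f (u, v) 1 - f (a, v) 1\<bar>)
      + (\<Sum>b\<in>{1..n} - {v}. 1 - \<bar>f (u, v) 1 - f (u, b) 1\<bar>)"
    by (simp add: sum.cartesian_product')
  also have "\<dots> = real m + real n - 2 - (\<Sum>a=1..m. \<bar>f (u, v) 1 - f (a, v) 1\<bar>)
        - (\<Sum>b=1..n. \<bar>f (u, v) 1 - f (u, b) 1\<bar>)"
    using u v by (simp add: sum_diff1 sum_subtractf)
  finally show ?thesis .
qed

text \<open>The largest defect of an optimal colouring is at least the average over all \<open>m n\<close> vertices. In
  the average each edge of a copy is counted from both ends, which is how the ordered pairs in
  \<open>sum_abs_diff_le\<close> arise.\<close>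

lemma min_defect_complete_prod_ge:
  assumes "m > 0" and "n > 0"
  shows "(real m - 1 - 2 * real (m\<^sup>2 div 4) / real m) + (real n - 1 - 2 * real (n\<^sup>2 div 4) / real n)
    \<le> min_defect (complete_graph m \<box> complete_graph n) 2"
proof -
  let ?G = "complete_graph m \<box> complete_graph n"
  have verts: "verts ?G = {1..m} \<times> {1..n}"
    by (simp add: cart_prod_def complete_graph_def)
  obtain f where f: "frac_coloring ?G 2 f" and f_min: "coloring_defect ?G 2 f = min_defect ?G 2"
    using min_defect_attained(1)[of ?G 2] assms verts
    by (auto simp: simple_cart_prod simple_complete_graph)
  define x where "x u v = f (u, v) 1" for u v
  have x01: "x u v \<in> {0..1}" if "u \<in> {1..m}" "v \<in> {1..n}" for u v
  proof -
    have "f (u, v) 1 \<ge> 0" "f (u, v) 2 \<ge> 0" "(\<Sum>j=1..2. f (u, v) j) = 1"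
      using f that verts by (auto simp: frac_coloring_def)
    then show ?thesis by (simp add: x_def numeral_2_eq_2)
  qed
  have columns: "(\<Sum>u=1..m. \<Sum>v=1..n. \<Sum>a=1..m. \<bar>x u v - x a v\<bar>) \<le> real n * (2 * real (m\<^sup>2 div 4))"
  proof -
    have "(\<Sum>v=1..n. \<Sum>u=1..m. \<Sum>a=1..m. \<bar>x u v - x a v\<bar>)
        \<le> (\<Sum>v=1..n. 2 * real ((card {1..m})\<^sup>2 div 4))"
      using x01 by (intro sum_mono sum_abs_diff_le) auto
    then show ?thesis by (subst sum.swap) simp
  qed
  have rows: "(\<Sum>u=1..m. \<Sum>v=1..n. \<Sum>b=1..n. \<bar>x u v - x u b\<bar>) \<le> real m * (2 * real (n\<^sup>2 div 4))"
  proof -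
    have "(\<Sum>u=1..m. \<Sum>v=1..n. \<Sum>b=1..n. \<bar>x u v - x u b\<bar>)
        \<le> (\<Sum>u=1..m. 2 * real ((card {1..n})\<^sup>2 div 4))"
      using x01 by (intro sum_mono sum_abs_diff_le) auto
    then show ?thesis by simp
  qed
  have "real m * real n * (real m + real n - 2)
        - real n * (2 * real (m\<^sup>2 div 4)) - real m * (2 * real (n\<^sup>2 div 4))
      \<le> real m * real n * (real m + real n - 2)
        - (\<Sum>u=1..m. \<Sum>v=1..n. \<Sum>a=1..m. \<bar>x u v - x a v\<bar>)
        - (\<Sum>u=1..m. \<Sum>v=1..n. \<Sum>b=1..n. \<bar>x u v - x u b\<bar>)"
    using columns rows by linarith
  also have "\<dots> = (\<Sum>u=1..m. \<Sum>v=1..n. real m + real n - 2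
        - (\<Sum>a=1..m. \<bar>x u v - x a v\<bar>) - (\<Sum>b=1..n. \<bar>x u v - x u b\<bar>))"
    by (simp add: sum_subtractf)
  also have "\<dots> = (\<Sum>u=1..m. \<Sum>v=1..n. vertex_defect ?G 2 f (u, v))"
    using vertex_defect_complete_prod[OF f] by (intro sum.cong refl) (simp add: x_def)
  also have "\<dots> \<le> (\<Sum>u=1..m. \<Sum>v=1..n. min_defect ?G 2)"
    unfolding f_min[symmetric] coloring_defect_def
    using verts by (intro sum_mono Max_ge) auto
  also have "\<dots> = real m * real n * min_defect ?G 2"
    by simp
  finally have "(real m * real n * (real m + real n - 2)
        - real n * (2 * real (m\<^sup>2 div 4)) - real m * (2 * real (n\<^sup>2 div 4))) / (real m * real n)
      \<le> min_defect ?G 2"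
    using assms by (simp add: pos_divide_le_eq mult.commute)
  also have "(real m * real n * (real m + real n - 2)
        - real n * (2 * real (m\<^sup>2 div 4)) - real m * (2 * real (n\<^sup>2 div 4))) / (real m * real n)
      = (real m - 1 - 2 * real (m\<^sup>2 div 4) / real m) + (real n - 1 - 2 * real (n\<^sup>2 div 4) / real n)"
    using assms by (simp add: field_simps)
  finally show ?thesis .
qed

lemma complete_factor_bound_even:
  assumes "s > 0" and "even s"
  shows "real s - 1 - 2 * real (s\<^sup>2 div 4) / real s = real s / 2 - 1"
proof -
  from \<open>even s\<close> obtain t where "s = 2 * t" ..
  with \<open>s > 0\<close> show ?thesis by (simp add: power2_eq_square)
qed

lemma complete_factor_bound_odd:
  assumes "odd s"
  shows "real s - 1 - 2 * real (s\<^sup>2 div 4) / real s = real s / 2 - 1 + 1 / (2 * real s)"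
proof -
  from \<open>odd s\<close> obtain t where s: "s = 2 * t + 1" ..
  have "s\<^sup>2 = 4 * (t * t + t) + 1"
    by (simp add: s power2_eq_square)
  then have "s\<^sup>2 div 4 = t * t + t" by simp
  then show ?thesis by (simp add: s field_simps)
qed

theorem corollary3:
  fixes m n :: nat
  assumes "m > 0" and "n > 0"
  shows "(odd m \<and> odd n \<longrightarrow>
      min_defect (complete_graph m \<box> complete_graph n) 2
        \<ge> (real m + real n) / 2 - 2 + 1 / (2 * real m) + 1 / (2 * real n)) \<and>
    (even m \<and> odd n \<longrightarrow>
      min_defect (complete_graph m \<box> complete_graph n) 2
        \<ge> (real m + real n) / 2 - 2 + 1 / (2 * real n))"
  using min_defect_complete_prod_ge[OF assms] complete_factor_bound_even[OF assms(1)]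
    complete_factor_bound_odd[of m] complete_factor_bound_odd[of n]
  by (auto simp: add_divide_distrib)

end
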